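(* Let $n_1,n_2\ge 2$, let $S_{n_1,n_2}$ be the double star of order $n_1+n_2$, and let $k\ge 3$. Then the spectrum of the adjacency matrix of the uniform double hyperstar $S_{n_1,n_2}^k$ is $$\sigma_A(S_{n_1,n_2}^k)=\begin{pmatrix}-1 & k-2 & r_1 & r_2 & r_3 & r_4 & r_5\\ (k-2)(n_1+n_2-1)-1 & n_1+n_2-4 & 1&1&1&1&1\end{pmatrix},$$ where $r_1,\dots,r_5$ are the roots (with multiplicity) of the equation \begin{align*} &\lambda^5-(-7+3k)\lambda^4+\bigl(17+3k^2+n_2+n_1-k(14+n_2+n_1)\bigr)\lambda^3\\ &-\bigl(-5(3+n_2+n_1)+k(17+7n_2+7n_1)-k^2(7+2n_2+2n_1)+k^3\bigr)\lambda^2\\ &-\bigl(-1+(-7+12k-6k^2+k^3)n_1+(7-5k+k^2+(1-k)n_1)(-1+k)n_2\bigr)\lambda\\ &-(-1+k)\bigl(-1+n_2+n_1+(3-4k+k^2)n_2n_1\bigr)=0. \end{align*}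
   Context: A hypergraph $G^*=(V,E)$ has a finite vertex set $V=\{v_1,\dots,v_N\}$ and a finite set $E$ of hyperedges, each a subset of $V$. Its adjacency matrix $A=(a_{ij})$ has $a_{ij}=|\{e\in E:\{v_i,v_j\}\subset e\}|$ for $i\ne j$ and $a_{ii}=0$. A star $S_n$ is the tree on $n$ vertices with one central vertex joined to the $n-1$ other vertices. The double star $S_{n_1,n_2}$ is the graph obtained from disjoint stars $S_{n_1}$ and $S_{n_2}$ by adding an edge joining their central vertices. The uniform double hyperstar $S_{n_1,n_2}^k$ is the $k$-th power of $S_{n_1,n_2}$: the $k$-uniform hypergraph obtained by adding to each edge of $S_{n_1,n_2}$ its own $k-2$ new vertices (so the hyperedges are the edges enlarged by pairwise disjoint sets of $k-2$ new vertices). The two-row notation for a spectrum lists eigenvalues in the first row and multiplicities in the second; it is read as a multiset (if listed values coincide, their multiplicities add, and multiplicity $0$ means the entry is absent). *)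

theory Defs
  imports "Jordan_Normal_Form.Char_Poly"
begin

type_synonym 'a hypergraph = "'a set \<times> 'a set set"

abbreviation verts :: "'a hypergraph \<Rightarrow> 'a set" where
  "verts G \<equiv> fst G"

abbreviation hedges :: "'a hypergraph \<Rightarrow> 'a set set" where
  "hedges G \<equiv> snd G"

definition hypergraph :: "'a hypergraph \<Rightarrow> bool" where
  "hypergraph G \<longleftrightarrow> finite (verts G) \<and> (\<forall>e \<in> hedges G. e \<subseteq> verts G)"

definition hypergraph_iso :: "'a hypergraph \<Rightarrow> 'b hypergraph \<Rightarrow> bool" where
  "hypergraph_iso G H \<longleftrightarrow>
     (\<exists>f. bij_betw f (verts G) (verts H) \<and> hedges H = (\<lambda>e. f ` e) ` hedges G)"

text \<open>The list \<open>vs\<close> is an enumeration of the vertex set. The entries are natural numbers; they are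
  embedded into the complex numbers so that the characteristic polynomial splits.\<close>

definition adjacency_matrix :: "'a list \<Rightarrow> 'a hypergraph \<Rightarrow> complex mat" where
  "adjacency_matrix vs G = mat (length vs) (length vs)
     (\<lambda>(i, j). if i = j then 0
               else of_nat (card {e \<in> hedges G. {vs ! i, vs ! j} \<subseteq> e}))"

definition eigenvalue_mset :: "complex mat \<Rightarrow> complex multiset" where
  "eigenvalue_mset A = proots (char_poly A)"

text \<open>The central vertex is \<open>0\<close>.\<close>

definition star :: "nat \<Rightarrow> nat hypergraph" where
  "star n = ({0..<n}, {{0, i} | i. 0 < i \<and> i < n})"

definition double_star :: "nat \<Rightarrow> nat \<Rightarrow> (nat + nat) hypergraph" where
  "double_star n1 n2 =
     (Inl ` verts (star n1) \<union> Inr ` verts (star n2),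
      {{Inl 0, Inr 0}} \<union> (\<lambda>e. Inl ` e) ` hedges (star n1) \<union> (\<lambda>e. Inr ` e) ` hedges (star n2))"

text \<open>The new vertices belonging to an edge \<open>e\<close> are the pairs \<open>(e, i)\<close> with \<open>i < k - 2\<close>.\<close>

definition hyperpower :: "nat \<Rightarrow> 'a hypergraph \<Rightarrow> ('a + 'a set \<times> nat) hypergraph" where
  "hyperpower k G =
     (Inl ` verts G \<union> Inr ` (hedges G \<times> {0..<k - 2}),
      (\<lambda>e. Inl ` e \<union> Inr ` ({e} \<times> {0..<k - 2})) ` hedges G)"

definition double_hyperstar ::
    "nat \<Rightarrow> nat \<Rightarrow> nat \<Rightarrow> ((nat + nat) + (nat + nat) set \<times> nat) hypergraph" where
  "double_hyperstar k n1 n2 = hyperpower k (double_star n1 n2)"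

definition double_hyperstar_quintic :: "complex \<Rightarrow> complex \<Rightarrow> complex \<Rightarrow> complex poly" where
  "double_hyperstar_quintic k n1 n2 =
     monom 1 5
     - monom (- 7 + 3 * k) 4
     + monom (17 + 3 * k^2 + n2 + n1 - k * (14 + n2 + n1)) 3
     - monom (- 5 * (3 + n2 + n1) + k * (17 + 7 * n2 + 7 * n1)
              - k^2 * (7 + 2 * n2 + 2 * n1) + k^3) 2
     - monom (- 1 + (- 7 + 12 * k - 6 * k^2 + k^3) * n1
              + (7 - 5 * k + k^2 + (1 - k) * n1) * (- 1 + k) * n2) 1
     - monom ((- 1 + k) * (- 1 + n2 + n1 + (3 - 4 * k + k^2) * n2 * n1)) 0"

end

theory Submission
  imports Defs
begin

text \<open>
  Let \<open>B\<close> be the vertex-edge incidence matrix and \<open>\<Delta>\<close> the diagonal matrix of degrees, so that the adjacency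
  matrix is \<open>B B\<^sup>T - \<Delta>\<close>. Writing a determinant as either Schur complement of one block matrix
  (Sylvester's determinant identity with diagonal weights) turns \<open>det (x I + \<Delta> - B B\<^sup>T)\<close> into a
  determinant indexed by hyperedges. All vertices other than the two centres have degree 1, so they
  contribute only to the diagonal there, and what remains is a diagonal matrix minus a matrix of
  rank 2. A second use of the same identity leaves a \<open>2 \<times> 2\<close> determinant indexed by the
  centres, whose numerator is the quintic. The divisions exclude finitely many \<open>x\<close>, which is harmless for
  an identity of polynomials.
\<close>

section \<open>Determinants of diagonal matrices minus products\<close>

text \<open>Both sides equal the determinant of the block matrix \<open>M\<close>. Multiplying on
  the right by \<open>U\<close> clears the block \<open>Y\<close> by means of \<open>E\<close>;
  multiplying on the left by \<open>L\<close> clears it by means of \<open>D\<close>. Both factors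
  are unitriangular, so no determinant changes.\<close>

lemma det_schur_complements:
  fixes D :: "'a :: idom mat"
  assumes D: "D \<in> carrier_mat n n" "D' \<in> carrier_mat n n" "D' * D = 1\<^sub>m n"
    and E: "E \<in> carrier_mat m m" "E' \<in> carrier_mat m m" "E * E' = 1\<^sub>m m"
    and X: "X \<in> carrier_mat n m" and Y: "Y \<in> carrier_mat m n"
  shows "det (D - X * (E' * Y)) * det E = det (E - Y * D' * X) * det D"
proof -
  define M where "M = four_block_mat D X Y E"
  define U where "U = four_block_mat (1\<^sub>m n) (0\<^sub>m n m) (- (E' * Y)) (1\<^sub>m m)"
  define L where "L = four_block_mat (1\<^sub>m n) (0\<^sub>m n m) (- (Y * D')) (1\<^sub>m m)"
  note carriers = D(1,2) E(1,2) X Y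
  have M: "M \<in> carrier_mat (n + m) (n + m)" and U: "U \<in> carrier_mat (n + m) (n + m)"
    and L: "L \<in> carrier_mat (n + m) (n + m)"
    using carriers by (auto simp: M_def U_def L_def)
  have "det U = 1" "det L = 1"
    using carriers by (simp_all add: U_def L_def det_four_block_mat_upper_right_zero[of _ n _ m])
  have "E * (- (E' * Y)) = - Y"
    using assoc_mult_mat[OF E(1,2) Y] carriers E(3) by simp
  then have MU: "M * U = four_block_mat (D - X * (E' * Y)) X (0\<^sub>m m n) E"
    unfolding M_def U_def using carriers
    by (subst mult_four_block_mat[of _ n n _ m _ m _ _ n _ m])
      (auto intro!: cong_four_block_mat)
  have "- (Y * D') * D = - Y"
    using carriers D(3) by (simp add: assoc_mult_mat[OF Y D(2,1)] )
  then have LM: "L * M = four_block_mat D X (0\<^sub>m m n) (E - Y * D' * X)"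
    unfolding M_def L_def using carriers
    by (subst mult_four_block_mat[of _ n n _ m _ m _ _ n _ m])
      (auto intro!: cong_four_block_mat)
  have "det (M * U) = det (L * M)"
    using \<open>det U = 1\<close> \<open>det L = 1\<close> by (simp add: det_mult[OF M U] det_mult[OF L M])
  then show ?thesis
    unfolding MU LM using carriers
    by (subst (asm) (1 2) det_four_block_mat_lower_left_zero[of _ n _ m])
      (auto simp: mult.commute minus_carrier_mat)
qed

section \<open>Matrices indexed by lists\<close>

text \<open>Entries are functions of vertices and edges rather than of positions. For distinct
  lists, the sums in a matrix product then run over sets.\<close>

definition list_mat :: "'a list \<Rightarrow> 'b list \<Rightarrow> ('a \<Rightarrow> 'b \<Rightarrow> 'c) \<Rightarrow> 'c mat" where
  "list_mat us ws f = mat (length us) (length ws) (\<lambda>(i, j). f (us ! i) (ws ! j))"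

lemma list_mat_carrier [simp]: "list_mat us ws f \<in> carrier_mat (length us) (length ws)"
  by (simp add: list_mat_def)

lemma list_mat_cong:
  "(\<And>u w. u \<in> set us \<Longrightarrow> w \<in> set ws \<Longrightarrow> f u w = g u w) \<Longrightarrow> list_mat us ws f = list_mat us ws g"
  by (auto simp: list_mat_def)

lemma sum_nth: "distinct us \<Longrightarrow> (\<Sum>i = 0..<length us. f (us ! i)) = (\<Sum>u\<in>set us. f u)"
  by (simp add: sum.distinct_set_conv_list sum_list_sum_nth)

lemma list_mat_mult:
  assumes "distinct ws"
  shows "list_mat us ws f * list_mat ws ts g = list_mat us ts (\<lambda>u t. \<Sum>w\<in>set ws. f u w * g w t)"
  unfolding list_mat_def
  by (rule eq_matI) (auto simp: scalar_prod_def sum_nth[OF assms, symmetric])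

lemma list_mat_minus: "list_mat us ws f - list_mat us ws g = list_mat us ws (\<lambda>u w. f u w - g u w)"
  by (auto simp: list_mat_def)

abbreviation list_diag :: "'a list \<Rightarrow> ('a \<Rightarrow> 'c :: zero) \<Rightarrow> 'c mat" where
  "list_diag us d \<equiv> list_mat us us (\<lambda>u u'. if u = u' then d u else 0)"

lemma det_list_diag:
  assumes "distinct us"
  shows "det (list_diag us d) = (\<Prod>u\<in>set us. d u :: 'c :: comm_ring_1)"
  using assms
  by (subst det_upper_triangular[of _ "length us"])
    (auto simp: list_mat_def upper_triangular_def nth_eq_iff_index_eq prod_list_diag_prod diag_mat_def
      prod.distinct_set_conv_list prod.list_conv_set_nth)

lemma list_diag_mult:
  assumes "distinct us"
  shows "list_diag us d * list_mat us ws f = list_mat us ws (\<lambda>u w. d u * f u w :: 'c :: comm_ring_1)"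
  unfolding list_mat_mult[OF assms]
  by (intro list_mat_cong) (simp add: if_distrib[of "\<lambda>x. x * _"] cong: if_cong)

lemma list_mult_diag:
  assumes "distinct ws"
  shows "list_mat us ws f * list_diag ws d = list_mat us ws (\<lambda>u w. f u w * d w :: 'c :: comm_ring_1)"
  unfolding list_mat_mult[OF assms]
  by (intro list_mat_cong) (simp add: if_distrib[of "\<lambda>x. _ * x"] cong: if_cong)

lemma list_diag_inverse:
  assumes "distinct us" "\<And>u. u \<in> set us \<Longrightarrow> d u * d' u = (1 :: 'c :: comm_ring_1)"
  shows "list_diag us d * list_diag us d' = 1\<^sub>m (length us)"
  unfolding list_diag_mult[OF assms(1)]
  using assms by (auto simp: list_mat_def nth_eq_iff_index_eq)

text \<open>This is \<open>det_schur_complements\<close> for diagonal blocks with entries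
  \<open>d\<close> and \<open>e\<close>, whose inverses can be written into the sums. It trades a
  determinant indexed by \<open>us\<close> for one indexed by \<open>ws\<close>.\<close>

lemma det_diag_minus_product:
  fixes d :: "'a \<Rightarrow> 'c :: field"
  assumes "distinct us" "distinct ws"
    and d: "\<And>u. u \<in> set us \<Longrightarrow> d u \<noteq> 0" and e: "\<And>w. w \<in> set ws \<Longrightarrow> e w \<noteq> 0"
  shows "det (list_mat us us (\<lambda>u u'. (if u = u' then d u else 0) - (\<Sum>w\<in>set ws. X u w * Y w u' / e w)))
        * (\<Prod>w\<in>set ws. e w) =
      det (list_mat ws ws (\<lambda>w w'. (if w = w' then e w else 0) - (\<Sum>u\<in>set us. Y w u * X u w' / d u)))
        * (\<Prod>u\<in>set us. d u)"
proof -
  let ?X = "list_mat us ws X" and ?Y = "list_mat ws us Y"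
  let ?D = "list_diag us d" and ?D' = "list_diag us (\<lambda>u. inverse (d u))"
  let ?E = "list_diag ws e" and ?E' = "list_diag ws (\<lambda>w. inverse (e w))"
  have "det (?D - ?X * (?E' * ?Y)) * det ?E = det (?E - ?Y * ?D' * ?X) * det ?D"
    using assms
    by (intro det_schur_complements[of _ "length us" _ _ "length ws"] list_diag_inverse) auto
  also have "?D - ?X * (?E' * ?Y) = list_mat us us
      (\<lambda>u u'. (if u = u' then d u else 0) - (\<Sum>w\<in>set ws. X u w * Y w u' / e w))"
    by (simp add: list_diag_mult list_mat_mult list_mat_minus assms divide_inverse ac_simps)
  also have "?E - ?Y * ?D' * ?X = list_mat ws ws
      (\<lambda>w w'. (if w = w' then e w else 0) - (\<Sum>u\<in>set us. Y w u * X u w' / d u))"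
    by (simp add: list_mult_diag list_mat_mult list_mat_minus assms divide_inverse ac_simps)
  finally show ?thesis
    unfolding det_list_diag[OF assms(1)] det_list_diag[OF assms(2)] .
qed

section \<open>Hypergraphs whose vertices outside a set of hubs are pendant\<close>

definition degree_in :: "'a set set \<Rightarrow> 'a \<Rightarrow> nat" where
  "degree_in E v = card {e \<in> E. v \<in> e}"

text \<open>The division by \<open>1\<close> brings the matrix into the shape of \<open>det_diag_minus_product\<close>.\<close>

lemma poly_char_poly_adjacency_matrix:
  assumes "distinct vs" and es: "distinct es" "set es = hedges G"
  shows "poly (char_poly (adjacency_matrix vs G)) x =
    det (list_mat vs vs (\<lambda>u v. (if u = v then x + of_nat (degree_in (hedges G) u) else 0)
      - (\<Sum>e\<in>set es. of_bool (u \<in> e) * of_bool (v \<in> e) / 1)))"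
proof -
  let ?A = "adjacency_matrix vs G" and ?n = "length vs"
  have A: "?A \<in> carrier_mat ?n ?n"
    by (simp add: adjacency_matrix_def)
  have fin: "finite (hedges G)"
    using es by (metis finite_set)
  have "(\<Sum>e\<in>hedges G. of_bool (u \<in> e) * of_bool (v \<in> e) :: complex) = of_nat (card {e \<in> hedges G. u \<in> e \<and> v \<in> e})"
    for u v
    using fin by (simp flip: of_bool_conj add: Int_def)
  \<comment> \<open>The left side is \<open>x I - A\<close>. On the diagonal the sum over edges is
    the degree, so adding the degree leaves just \<open>x\<close>.\<close>
  then have "- char_matrix ?A x = list_mat vs vs
      (\<lambda>u v. (if u = v then x + of_nat (degree_in (hedges G) u) else 0)
        - (\<Sum>e\<in>set es. of_bool (u \<in> e) * of_bool (v \<in> e) / 1))"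
    unfolding es(2)
    by (intro eq_matI)
      (use assms(1) in \<open>auto simp: char_matrix_def adjacency_matrix_def list_mat_def degree_in_def
        nth_eq_iff_index_eq\<close>)
  then show ?thesis
    by (simp add: char_poly_matrix[OF A])
qed

text \<open>A vertex outside \<open>C\<close> lies in only one edge, so it contributes only when
  \<open>e = e'\<close>, and then \<open>1 / a\<close>. The sum is an entry of the edge-indexed
  matrix, whose off-diagonal part thus comes from \<open>C\<close> alone.\<close>

lemma sum_pendant_vertices:
  fixes w :: "'a \<Rightarrow> 'c :: field"
  assumes "finite V" "finite E" "C \<subseteq> V" "e \<in> E" "e' \<in> E" "e \<subseteq> V"
    and pendant: "\<And>v. v \<in> V - C \<Longrightarrow> degree_in E v = 1"
    and w: "\<And>v. v \<in> V - C \<Longrightarrow> w v = a"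
  shows "(\<Sum>v\<in>V. of_bool (v \<in> e) * of_bool (v \<in> e') / w v) =
    (if e = e' then of_nat (card (e - C)) / a else 0) + (\<Sum>c\<in>C. of_bool (c \<in> e) * of_bool (c \<in> e') / w c)"
proof -
  have "e = e'" if v: "v \<in> V - C" "v \<in> e" "v \<in> e'" for v
  proof -
    have "is_singleton {e \<in> E. v \<in> e}"
      using pendant[OF v(1)] by (simp add: is_singleton_altdef degree_in_def)
    moreover have "e \<in> {e \<in> E. v \<in> e}" "e' \<in> {e \<in> E. v \<in> e}"
      using v assms(4,5) by simp_all
    ultimately show ?thesis
      by (metis is_singletonE singletonD)
  qed
  then have "(\<Sum>v\<in>V - C. of_bool (v \<in> e) * of_bool (v \<in> e') / w v) =
      (\<Sum>v\<in>V - C. if e = e' then of_bool (v \<in> e) / a else 0)"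
    using w by (intro sum.cong) auto
  also have "\<dots> = (if e = e' then of_nat (card (e - C)) / a else 0)"
  proof -
    have "(V - C) \<inter> e = e - C"
      using assms(6) by blast
    then have "(\<Sum>v\<in>V - C. of_bool (v \<in> e) :: 'c) = of_nat (card (e - C))"
      using assms(1) by (subst sum_of_bool_eq) auto
    then show ?thesis
      by (auto simp flip: sum_divide_distrib)
  qed
  finally show ?thesis
    using assms(1,3) by (simp add: sum.subset_diff)
qed

text \<open>The determinant passes from vertices to edges and from edges to hubs. After the first
  passage the pendant vertices survive only in the diagonal entries \<open>g\<close>. The conditions
  on \<open>x\<close> make every divisor nonzero.\<close>

lemma char_poly_adjacency_matrix_hubs:
  fixes x :: complex
  defines "g \<equiv> \<lambda>C e. 1 - of_nat (card (e - C)) / (x + 1)"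
  assumes vs: "distinct vs" "set vs = verts G" and G: "hypergraph G" "finite (hedges G)"
    and cs: "distinct cs" "set cs \<subseteq> verts G"
    and pendant: "\<And>v. v \<in> verts G - set cs \<Longrightarrow> degree_in (hedges G) v = 1"
    and x: "x + 1 \<noteq> 0" "\<And>c. c \<in> set cs \<Longrightarrow> x + of_nat (degree_in (hedges G) c) \<noteq> 0"
      "\<And>e. e \<in> hedges G \<Longrightarrow> g (set cs) e \<noteq> 0"
  shows "poly (char_poly (adjacency_matrix vs G)) x =
    (x + 1) ^ card (verts G - set cs) * (\<Prod>e\<in>hedges G. g (set cs) e) *
    det (list_mat cs cs (\<lambda>c c'. (if c = c' then x + of_nat (degree_in (hedges G) c) else 0)
      - (\<Sum>e\<in>hedges G. of_bool (c \<in> e) * of_bool (c' \<in> e) / g (set cs) e)))"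
proof -
  let ?V = "verts G" and ?E = "hedges G" and ?C = "set cs"
  let ?d = "\<lambda>v. x + of_nat (degree_in ?E v)"
  obtain es where es: "distinct es" "set es = ?E"
    using finite_distinct_list[OF G(2)] by auto
  have V: "finite ?V" "\<And>e. e \<in> ?E \<Longrightarrow> e \<subseteq> ?V"
    using G(1) by (auto simp: hypergraph_def)
  have d: "?d v = x + 1" if "v \<in> ?V - ?C" for v
    using pendant[OF that] by simp
  have d0: "?d v \<noteq> 0" if "v \<in> ?V" for v
    using d[of v] x(1,2) that by (cases "v \<in> ?C") auto
  define M where "M = list_mat es es (\<lambda>e f. (if e = f then 1 else 0)
      - (\<Sum>v\<in>set vs. of_bool (v \<in> e) * of_bool (v \<in> f) / ?d v))"
  have "poly (char_poly (adjacency_matrix vs G)) x = det M * (\<Prod>v\<in>?V. ?d v)"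
    unfolding poly_char_poly_adjacency_matrix[OF vs(1) es] M_def
    using det_diag_minus_product[OF vs(1) es(1), of ?d "\<lambda>_. 1"
        "\<lambda>v e. of_bool (v \<in> e)" "\<lambda>e v. of_bool (v \<in> e)"] d0
    by (simp add: vs(2))
  \<comment> \<open>The hub factors are split off because the second exchange absorbs exactly their
    product.\<close>
  also have "(\<Prod>v\<in>?V. ?d v) = (x + 1) ^ card (?V - ?C) * (\<Prod>c\<in>?C. ?d c)"
    using d by (simp add: prod.subset_diff[OF cs(2) V(1)])
  also have "M = list_mat es es (\<lambda>e f. (if e = f then g ?C e else 0)
      - (\<Sum>c\<in>?C. of_bool (c \<in> e) * of_bool (c \<in> f) / ?d c))"
    unfolding M_def
  proof (rule list_mat_cong)
    fix e f assume "e \<in> set es" "f \<in> set es"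
    then show "(if e = f then 1 else 0) - (\<Sum>v\<in>set vs. of_bool (v \<in> e) * of_bool (v \<in> f) / ?d v) =
       (if e = f then g ?C e else 0) - (\<Sum>c\<in>?C. of_bool (c \<in> e) * of_bool (c \<in> f) / ?d c)"
      using V sum_pendant_vertices[of ?V ?E ?C e f ?d, OF V(1) G(2) cs(2) _ _ _ pendant d]
      by (simp add: es(2) vs(2) g_def)
  qed
  finally have "poly (char_poly (adjacency_matrix vs G)) x = (x + 1) ^ card (?V - ?C) *
      (det (list_mat es es (\<lambda>e f. (if e = f then g ?C e else 0)
        - (\<Sum>c\<in>?C. of_bool (c \<in> e) * of_bool (c \<in> f) / ?d c))) * (\<Prod>c\<in>?C. ?d c))"
    by (simp only: ac_simps)
  \<comment> \<open>Now the edges carry the diagonal \<open>g\<close> and the hubs play the part of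
    the second index set.\<close>
  also have "det (list_mat es es (\<lambda>e f. (if e = f then g ?C e else 0)
        - (\<Sum>c\<in>?C. of_bool (c \<in> e) * of_bool (c \<in> f) / ?d c))) * (\<Prod>c\<in>?C. ?d c) =
      det (list_mat cs cs (\<lambda>c c'. (if c = c' then ?d c else 0)
      - (\<Sum>e\<in>?E. of_bool (c \<in> e) * of_bool (c' \<in> e) / g ?C e))) * (\<Prod>e\<in>?E. g ?C e)"
    using det_diag_minus_product[OF es(1) cs(1), of "g ?C" ?d
        "\<lambda>e c. of_bool (c \<in> e)" "\<lambda>c e. of_bool (c \<in> e)"] x(2,3)
    by (simp add: es(2))
  finally show ?thesis
    by (simp only: ac_simps)
qed

section \<open>Hyperpowers and double stars\<close>

text \<open>Taking images under \<open>f\<close> matches the edges through \<open>u\<close> and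
  \<open>v\<close> with those through \<open>f u\<close> and \<open>f v\<close>. Since the
  enumeration is transported as well, the matrices are equal and not merely similar.\<close>

lemma adjacency_matrix_iso:
  assumes "bij_betw f (verts H) (verts G)" "hedges G = (\<lambda>e. f ` e) ` hedges H"
    and "hypergraph H" "set vs = verts H"
  shows "adjacency_matrix vs H = adjacency_matrix (map f vs) G"
proof -
  have inj: "inj_on f (verts H)"
    using assms(1) by (rule bij_betw_imp_inj_on)
  have sub: "e \<subseteq> verts H" if "e \<in> hedges H" for e
    using assms(3) that by (auto simp: hypergraph_def)
  have "card {e \<in> hedges H. {u, v} \<subseteq> e} = card {e \<in> hedges G. {f u, f v} \<subseteq> e}"
    if uv: "u \<in> verts H" "v \<in> verts H" for u v
  proof (rule bij_betw_same_card)
    have mem: "f w \<in> f ` e \<longleftrightarrow> w \<in> e" if "e \<in> hedges H" "w \<in> verts H" for e w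
      using inj_on_image_mem_iff[OF inj that(2) sub[OF that(1)]] .
    have "(\<lambda>e. f ` e) ` {e \<in> hedges H. {u, v} \<subseteq> e} = {e \<in> hedges G. {f u, f v} \<subseteq> e}"
    proof -
      have "{e \<in> (\<lambda>e. f ` e) ` hedges H. {f u, f v} \<subseteq> e} = (\<lambda>e. f ` e) ` {e \<in> hedges H. {f u, f v} \<subseteq> f ` e}"
        by (rule Compr_image_eq)
      also have "{e \<in> hedges H. {f u, f v} \<subseteq> f ` e} = {e \<in> hedges H. {u, v} \<subseteq> e}"
        using mem uv by (intro Collect_cong conj_cong refl) simp
      finally show ?thesis
        unfolding assms(2) by (rule sym)
    qed
    moreover have "inj_on (\<lambda>e. f ` e) (hedges H)"
      using sub inj by (meson Pow_iff inj_on_image_Pow inj_on_subset subsetI)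
    ultimately show "bij_betw (\<lambda>e. f ` e) {e \<in> hedges H. {u, v} \<subseteq> e} {e \<in> hedges G. {f u, f v} \<subseteq> e}"
      unfolding bij_betw_def by (simp add: inj_on_def)
  qed
  moreover have "vs ! i \<in> verts H" if "i < length vs" for i
    using that assms(4) by (metis nth_mem)
  ultimately show ?thesis
    by (auto simp: adjacency_matrix_def)
qed

section \<open>Edges and degrees of hyperpowers\<close>

text \<open>Naming this map lets sums and products over the enlarged edges be reindexed by the
  original ones.\<close>

definition hyperpower_edge :: "nat \<Rightarrow> 'a set \<Rightarrow> ('a + 'a set \<times> nat) set" where
  "hyperpower_edge k e = Inl ` e \<union> Inr ` ({e} \<times> {0..<k - 2})"

lemma hyperpower_simps:
  "verts (hyperpower k G) = Inl ` verts G \<union> Inr ` (hedges G \<times> {0..<k - 2})"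
  "hedges (hyperpower k G) = hyperpower_edge k ` hedges G"
  by (simp_all add: hyperpower_def hyperpower_edge_def)

lemma mem_hyperpower_edge [simp]:
  "Inl v \<in> hyperpower_edge k e \<longleftrightarrow> v \<in> e"
  "Inr (f, i) \<in> hyperpower_edge k e \<longleftrightarrow> f = e \<and> i < k - 2"
  by (auto simp: hyperpower_edge_def)

text \<open>The old vertices in an enlarged edge already determine the original edge.\<close>

lemma inj_hyperpower_edge: "inj (hyperpower_edge k)"
  by (rule injI) (metis mem_hyperpower_edge(1) subsetI subset_antisym)

lemma hypergraph_hyperpower:
  assumes "hypergraph G"
  shows "hypergraph (hyperpower k G)" "finite (hedges (hyperpower k G))"
proof -
  have "finite (hedges G)"
    using assms by (meson Pow_iff finite_Pow_iff finite_subset hypergraph_def subsetI)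
  then show "hypergraph (hyperpower k G)" "finite (hedges (hyperpower k G))"
    using assms by (auto simp: hypergraph_def hyperpower_simps hyperpower_edge_def)
qed

text \<open>By injectivity of the enlargement, degrees can be counted over the edges of
  \<open>G\<close>: an old vertex keeps its edges, and \<open>(e, i)\<close> meets only the
  enlargement of \<open>e\<close>.\<close>

lemma degree_in_hyperpower:
  "degree_in (hedges (hyperpower k G)) (Inl v) = degree_in (hedges G) v"
  "e \<in> hedges G \<Longrightarrow> i < k - 2 \<Longrightarrow> degree_in (hedges (hyperpower k G)) (Inr (e, i)) = 1"
proof -
  have *: "degree_in (hedges (hyperpower k G)) v = card {e \<in> hedges G. v \<in> hyperpower_edge k e}" for v
  proof -
    have "{e \<in> hyperpower_edge k ` hedges G. v \<in> e} =
        hyperpower_edge k ` {e \<in> hedges G. v \<in> hyperpower_edge k e}"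
      by auto
    then show ?thesis
      by (simp add: degree_in_def hyperpower_simps card_image inj_on_subset[OF inj_hyperpower_edge])
  qed
  show "degree_in (hedges (hyperpower k G)) (Inl v) = degree_in (hedges G) v"
    unfolding * by (simp add: degree_in_def)
  assume "e \<in> hedges G" "i < k - 2"
  then have "{f \<in> hedges G. Inr (e, i) \<in> hyperpower_edge k f} = {e}"
    by auto
  then show "degree_in (hedges (hyperpower k G)) (Inr (e, i)) = 1"
    unfolding * by simp
qed

text \<open>With hubs among the old vertices, this is the count of non-hub vertices that enters
  \<open>g\<close>.\<close>

lemma card_hyperpower_edge_diff:
  assumes "finite e"
  shows "card (hyperpower_edge k e - Inl ` C) = card (e - C) + (k - 2)"
proof -
  have *: "hyperpower_edge k e - Inl ` C = Inl ` (e - C) \<union> Inr ` ({e} \<times> {0..<k - 2})"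
    by (auto simp: hyperpower_edge_def)
  show ?thesis
    unfolding * using assms by (subst card_Un_disjoint) (auto simp: card_image card_cartesian_product)
qed

lemma card_verts_hyperpower:
  assumes "finite (verts G)" "finite (hedges G)"
  shows "card (verts (hyperpower k G)) = card (verts G) + card (hedges G) * (k - 2)"
  using assms unfolding hyperpower_simps
  by (subst card_Un_disjoint) (auto simp: card_image card_cartesian_product)

section \<open>Edges and degrees of double stars\<close>

lemma hedges_double_star:
  "hedges (double_star n1 n2) = insert {Inl 0, Inr 0}
    ((\<lambda>i. {Inl 0, Inl i}) ` {1..<n1} \<union> (\<lambda>i. {Inr 0, Inr i}) ` {1..<n2})"
proof -
  have "hedges (star n) = (\<lambda>i. {0, i}) ` {1..<n}" for n
    by (auto simp: star_def)
  then show ?thesis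
    by (simp add: double_star_def image_image)
qed

lemma hypergraph_double_star:
  assumes "n1 \<ge> 1" "n2 \<ge> 1"
  shows "hypergraph (double_star n1 n2)"
  unfolding hypergraph_def hedges_double_star
  using assms by (auto simp: double_star_def star_def)

text \<open>Stated for an arbitrary commutative monoid so that it serves both sums (degrees, edge
  count, hub matrix) and products (of \<open>g\<close>). The three families are disjoint, as only
  the central edge meets both sides.\<close>

lemma (in comm_monoid_set) double_star_edges:
  "F g (hedges (double_star n1 n2)) = f (g {Inl 0, Inr 0})
    (f (F (\<lambda>i. g {Inl 0, Inl i}) {1..<n1}) (F (\<lambda>i. g {Inr 0, Inr i}) {1..<n2}))"
proof -
  have inj: "inj_on (\<lambda>i. {Inl 0 :: nat + nat, Inl i}) {1..<n1}"
      "inj_on (\<lambda>i. {Inr 0 :: nat + nat, Inr i}) {1..<n2}"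
    by (auto simp: inj_on_def doubleton_eq_iff)
  show ?thesis
    unfolding hedges_double_star
    by (subst insert, simp, force simp: doubleton_eq_iff, subst union_disjoint)
      (auto simp: reindex[OF inj(1), unfolded One_nat_def] reindex[OF inj(2), unfolded One_nat_def] o_def
        doubleton_eq_iff)
qed

lemma degree_in_eq_sum: "finite E \<Longrightarrow> degree_in E v = (\<Sum>e\<in>E. of_bool (v \<in> e))"
  by (simp add: degree_in_def Int_def)

lemma finite_hedges_double_star: "finite (hedges (double_star n1 n2))"
  by (simp add: hedges_double_star)

text \<open>A star on \<open>n1\<close> vertices has \<open>n1 - 1\<close> leaves; the central edge
  raises the degree of its centre to \<open>n1\<close>.\<close>

lemma degree_in_double_star:
  assumes "n1 \<ge> 1" "n2 \<ge> 1"
  shows "degree_in (hedges (double_star n1 n2)) (Inl i) = (if i = 0 then n1 else if i < n1 then 1 else 0)"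
    and "degree_in (hedges (double_star n1 n2)) (Inr i) = (if i = 0 then n2 else if i < n2 then 1 else 0)"
  using assms
  by (auto simp: degree_in_eq_sum[OF finite_hedges_double_star] sum.double_star_edges)

lemma card_hedges_double_star:
  assumes "n1 \<ge> 1" "n2 \<ge> 1"
  shows "card (hedges (double_star n1 n2)) = n1 + n2 - 1"
  using assms sum.double_star_edges[of "\<lambda>_. 1 :: nat" n1 n2] by simp

lemma verts_double_star: "verts (double_star n1 n2) = Inl ` {0..<n1} \<union> Inr ` {0..<n2}"
  by (simp add: double_star_def star_def)

lemma card_verts_double_star: "card (verts (double_star n1 n2)) = n1 + n2"
  unfolding verts_double_star by (subst card_Un_disjoint) (auto simp: card_image)

section \<open>The spectrum of the double hyperstar\<close>

lemma det_list_mat_pair: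
  "det (list_mat [a, b] [a, b] f) = f a a * f b b - f a b * f b a"
  by (simp add: list_mat_def laplace_expansion_row[of _ 2 0] lessThan_Suc numeral_2_eq_2 cofactor_def mat_delete_def det_single)

text \<open>Otherwise the nonzero difference would have infinitely many roots. This permits
  discarding the \<open>x\<close> at which a divisor vanishes.\<close>

lemma poly_eqI_cofinite:
  fixes p q :: "'a :: {idom, ring_char_0} poly"
  assumes "finite S" "\<And>x. x \<notin> S \<Longrightarrow> poly p x = poly q x"
  shows "p = q"
proof (rule ccontr)
  assume "p \<noteq> q"
  then have "finite {x. poly (p - q) x = 0}"
    by (intro poly_roots_finite) simp
  moreover have "- S \<subseteq> {x. poly (p - q) x = 0}"
    using assms(2) by auto
  ultimately have "finite (UNIV :: 'a set)"
    using assms(1) by (metis Compl_eq_Diff_UNIV finite_Diff2 finite_subset)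
  then show False
    using infinite_UNIV_char_0 by blast
qed

text \<open>Here \<open>s / r\<close> and \<open>s / q\<close> are the values of
  \<open>1 / g\<close> at the central edge and at the other edges. The large bracket is the
  determinant of the hub matrix, and \<open>r * q\<^sup>2\<close> clears its denominators.\<close>

lemma double_hyperstar_quintic_eval:
  fixes x K N1 N2 :: complex
  assumes "s = x + 1" "q = x + 2 - K" "r = x + 3 - K" "s \<noteq> 0" "q \<noteq> 0" "r \<noteq> 0"
  shows "r * q\<^sup>2 * ((x + N1 - (s / r + (N1 - 1) * (s / q))) * (x + N2 - (s / r + (N2 - 1) * (s / q))) - (s / r)\<^sup>2)
    = poly (double_hyperstar_quintic K N1 N2) x"
proof -
  \<comment> \<open>The factor \<open>r\<close> in the denominator cancels because the terms \<open>(s / r)\<^sup>2\<close> do.\<close>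
  define p1 where "p1 = (x + N1) * q - (N1 - 1) * s"
  define p2 where "p2 = (x + N2) * q - (N2 - 1) * s"
  have 1: "x + N1 - (s / r + (N1 - 1) * (s / q)) = p1 / q - s / r"
    using assms(4-) by (simp add: p1_def field_simps)
  have 2: "x + N2 - (s / r + (N2 - 1) * (s / q)) = p2 / q - s / r"
    using assms(4-) by (simp add: p2_def field_simps)
  have "r * q\<^sup>2 * ((p1 / q - s / r) * (p2 / q - s / r) - (s / r)\<^sup>2) = r * p1 * p2 - s * q * (p1 + p2)"
    using assms(4-) by (simp add: field_simps power2_eq_square)
  also have "\<dots> = poly (double_hyperstar_quintic K N1 N2) x"
    unfolding double_hyperstar_quintic_def p1_def p2_def assms(1-3)
    by (simp add: poly_monom algebra_simps eval_nat_numeral)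
  finally show ?thesis
    unfolding 1 2 .
qed

text \<open>The hub formula is applied with the two centres as hubs. The linear factors are the
  powers of \<open>s = x + 1\<close> and \<open>q = x - (k - 2)\<close> left over once the
  denominators of the hub determinant are cleared.\<close>

lemma char_poly_double_hyperstar:
  assumes n: "n1 \<ge> 2" "n2 \<ge> 2" and k: "k \<ge> 3"
    and vs: "distinct vs" "set vs = verts (double_hyperstar k n1 n2)"
  shows "char_poly (adjacency_matrix vs (double_hyperstar k n1 n2)) =
    [:1, 1:] ^ ((k - 2) * (n1 + n2 - 1) - 1) * [:- of_nat (k - 2), 1:] ^ (n1 + n2 - 4) *
    double_hyperstar_quintic (of_nat k) (of_nat n1) (of_nat n2)"
proof (rule poly_eqI_cofinite)
  let ?S = "double_star n1 n2" and ?H = "double_hyperstar k n1 n2"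
  let ?C = "{Inl 0, Inr 0 :: nat + nat}"
  define cs :: "((nat + nat) + (nat + nat) set \<times> nat) list" where "cs = [Inl (Inl 0), Inl (Inr 0)]"
  let ?a = "Inl (Inl 0) :: (nat + nat) + (nat + nat) set \<times> nat"
    and ?b = "Inl (Inr 0) :: (nat + nat) + (nat + nat) set \<times> nat"
  define K N1 N2 :: complex where KN: "K = of_nat k" "N1 = of_nat n1" "N2 = of_nat n2"
  \<comment> \<open>These are the zeros of \<open>s\<close>, \<open>x + N1\<close>,
    \<open>x + N2\<close>, \<open>q\<close> and \<open>r\<close>.\<close>
  show "finite {- 1, - N1, - N2, K - 2, K - 3}"
    by simp
  fix x :: complex assume x: "x \<notin> {- 1, - N1, - N2, K - 2, K - 3}"
  define s q r where sqr: "s = x + 1" "q = x + 2 - K" "r = x + 3 - K"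
  have nz: "s \<noteq> 0" "q \<noteq> 0" "r \<noteq> 0" "x + N1 \<noteq> 0" "x + N2 \<noteq> 0"
    using x by (auto simp: sqr algebra_simps add_eq_0_iff)
  have n': "n1 \<ge> 1" "n2 \<ge> 1"
    using n by auto
  note deg = degree_in_double_star[OF n']
  have K2: "of_nat (k - 2) = K - 2"
    using k by (simp add: KN)
  define g where "g = (\<lambda>e. 1 - of_nat (card (e - set cs)) / (x + 1))"
  have cs: "set cs = Inl ` ?C"
    by (simp add: cs_def)
  have g: "g (hyperpower_edge k e) = 1 - (of_nat (card (e - ?C)) + (K - 2)) / s" if "finite e" for e
    unfolding g_def cs card_hyperpower_edge_diff[OF that] by (simp add: K2 sqr)
  \<comment> \<open>The central edge contains both centres and hence \<open>k - 2\<close> pendant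
    vertices; every other edge contains one centre and \<open>k - 1\<close> pendant
    vertices.\<close>
  have g_edges: "g (hyperpower_edge k {Inl 0, Inr 0}) = r / s"
    "i > 0 \<Longrightarrow> g (hyperpower_edge k {Inl 0, Inl i}) = q / s"
    "i > 0 \<Longrightarrow> g (hyperpower_edge k {Inr 0, Inr i}) = q / s" for i
    using nz by (simp_all add: g insert_Diff_if sqr field_simps)
  have "verts ?H - set cs = Inl ` (verts ?S - ?C) \<union> Inr ` (hedges ?S \<times> {0..<k - 2})"
    by (auto simp: double_hyperstar_def hyperpower_simps cs)
  then have pendant: "degree_in (hedges ?H) v = 1" if "v \<in> verts ?H - set cs" for v
    using that by (auto simp: double_hyperstar_def degree_in_hyperpower deg verts_double_star)
  have sub: "set cs \<subseteq> verts ?H"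
    using n' by (auto simp: double_hyperstar_def hyperpower_simps cs verts_double_star)
  have degcs: "degree_in (hedges ?H) ?a = n1" "degree_in (hedges ?H) ?b = n2"
    by (simp_all add: double_hyperstar_def degree_in_hyperpower deg)
  have sum_H: "(\<Sum>e\<in>hedges ?H. h e) = h (hyperpower_edge k {Inl 0, Inr 0}) +
      ((\<Sum>i\<in>{1..<n1}. h (hyperpower_edge k {Inl 0, Inl i})) + (\<Sum>i\<in>{1..<n2}. h (hyperpower_edge k {Inr 0, Inr i})))"
    for h :: "((nat + nat) + (nat + nat) set \<times> nat) set \<Rightarrow> complex"
    by (simp add: double_hyperstar_def hyperpower_simps sum.reindex[OF inj_on_subset[OF inj_hyperpower_edge]]
        sum.double_star_edges)
  have "(\<Prod>e\<in>hedges ?H. g e) = r / s * ((q / s) ^ (n1 - 1) * (q / s) ^ (n2 - 1))"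
    by (simp add: double_hyperstar_def hyperpower_simps prod.reindex[OF inj_on_subset[OF inj_hyperpower_edge]]
        prod.double_star_edges g_edges)
  then have prod_g: "(\<Prod>e\<in>hedges ?H. g e) = r / s * (q / s) ^ (n1 + n2 - 2)"
    using n by (simp flip: power_add add: numeral_2_eq_2)
  have g0: "g e \<noteq> 0" if "e \<in> hedges ?H" for e
    using that nz g_edges
    by (auto simp: double_hyperstar_def hyperpower_simps hedges_double_star)
  define M where "M = (k - 2) * (n1 + n2 - 1) - 1"
  define p where "p = n1 + n2 - 4"
  have "(k - 2) * (n1 + n2 - 1) \<ge> 1"
    using n k by simp arith
  moreover have "card (verts ?H) = n1 + n2 + (n1 + n2 - 1) * (k - 2)"
    using hypergraph_double_star[OF n']
    by (simp add: double_hyperstar_def card_verts_hyperpower finite_hedges_double_star hypergraph_def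
        card_hedges_double_star[OF n'] card_verts_double_star)
  \<comment> \<open>No subtraction in \<open>M\<close> or \<open>p\<close> is truncated, so removing
    two centres leaves \<open>(M + 1) + (p + 4) - 2\<close> vertices.\<close>
  ultimately have card: "card (verts ?H - set cs) = M + (p + 3)"
    using sub n by (simp add: card_Diff_subset M_def p_def) (simp add: cs_def mult.commute)
  have H: "hypergraph ?H" "finite (hedges ?H)"
    using hypergraph_hyperpower[OF hypergraph_double_star[OF n']] by (simp_all add: double_hyperstar_def)
  have "poly (char_poly (adjacency_matrix vs ?H)) x =
    (x + 1) ^ card (verts ?H - set cs) * (\<Prod>e\<in>hedges ?H. g e) *
    det (list_mat cs cs (\<lambda>c c'. (if c = c' then x + of_nat (degree_in (hedges ?H) c) else 0)
      - (\<Sum>e\<in>hedges ?H. of_bool (c \<in> e) * of_bool (c' \<in> e) / g e)))"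
    unfolding g_def
  proof (rule char_poly_adjacency_matrix_hubs[OF vs H])
    show "x + complex_of_nat (degree_in (hedges ?H) c) \<noteq> 0" if "c \<in> set cs" for c
      using that nz degcs by (auto simp: cs_def KN)
  qed (use sub pendant nz(1) g0 in \<open>auto simp: sqr g_def cs_def\<close>)
  \<comment> \<open>Only the central edge contains both centres, so each off-diagonal entry is
    \<open>- (s / r)\<close>. A diagonal entry also collects \<open>s / q\<close> from each leaf
    edge at that centre.\<close>
  also have "det (list_mat cs cs (\<lambda>c c'. (if c = c' then x + of_nat (degree_in (hedges ?H) c) else 0)
      - (\<Sum>e\<in>hedges ?H. of_bool (c \<in> e) * of_bool (c' \<in> e) / g e))) =
    (x + N1 - (s / r + (N1 - 1) * (s / q))) * (x + N2 - (s / r + (N2 - 1) * (s / q))) - (s / r)\<^sup>2"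
    unfolding cs_def det_list_mat_pair sum_H using n' g_edges
    by (simp add: degcs KN power2_eq_square)
  \<comment> \<open>Of the \<open>M + p + 3\<close> factors \<open>s\<close>, one cancels against
    \<open>r / s\<close> and \<open>p + 2\<close> against the powers of \<open>q / s\<close>. Two
    factors \<open>q\<close> are kept with \<open>r\<close> for the quintic.\<close>
  also have "(x + 1) ^ card (verts ?H - set cs) * (\<Prod>e\<in>hedges ?H. g e) * \<dots> = s ^ M * q ^ p * (r * q\<^sup>2 * \<dots>)"
  proof -
    have "n1 + n2 - 2 = p + 2"
      using n by (simp add: p_def)
    then have "(x + 1) ^ card (verts ?H - set cs) * (\<Prod>e\<in>hedges ?H. g e) = s ^ M * q ^ p * (r * q\<^sup>2)"
      using nz unfolding card prod_g
      by (simp add: sqr(1)[symmetric] power_add power_divide power2_eq_square power3_eq_cube)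
    then show ?thesis
      by (simp only: mult.assoc)
  qed
  also have "\<dots> = s ^ M * q ^ p * poly (double_hyperstar_quintic K N1 N2) x"
    using double_hyperstar_quintic_eval[OF sqr nz(1-3)] by simp
  finally show "poly (char_poly (adjacency_matrix vs ?H)) x =
    poly ([:1, 1:] ^ ((k - 2) * (n1 + n2 - 1) - 1) * [:- of_nat (k - 2), 1:] ^ (n1 + n2 - 4) *
      double_hyperstar_quintic (of_nat k) (of_nat n1) (of_nat n2)) x"
    by (simp add: M_def p_def KN sqr K2[unfolded KN] algebra_simps)
qed

text \<open>The leading term is \<open>monom 1 5\<close>. The degree shows that the quintic is
  nonzero and has exactly five complex roots with multiplicity.\<close>

lemma degree_double_hyperstar_quintic: "degree (double_hyperstar_quintic K N1 N2) = 5"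
  by (rule antisym[OF degree_le le_degree]) (auto simp: double_hyperstar_quintic_def)

theorem theorem5p1:
  fixes n1 n2 k :: nat
    and H :: "'a hypergraph"
    and vs :: "'a list"
  assumes "n1 \<ge> 2" and "n2 \<ge> 2" and "k \<ge> 3"
    and "hypergraph H"
    and "hypergraph_iso H (double_hyperstar k n1 n2)"
    and "distinct vs" and "set vs = verts H"
  shows "\<exists>r1 r2 r3 r4 r5 :: complex.
    proots (double_hyperstar_quintic (of_nat k) (of_nat n1) (of_nat n2)) = {#r1, r2, r3, r4, r5#} \<and>
    eigenvalue_mset (adjacency_matrix vs H) =
      replicate_mset ((k - 2) * (n1 + n2 - 1) - 1) (- 1)
      + replicate_mset (n1 + n2 - 4) (of_nat (k - 2))
      + {#r1, r2, r3, r4, r5#}"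
proof -
  let ?Q = "double_hyperstar_quintic (of_nat k) (of_nat n1) (of_nat n2)"
  obtain f where f: "bij_betw f (verts H) (verts (double_hyperstar k n1 n2))"
      "hedges (double_hyperstar k n1 n2) = (\<lambda>e. f ` e) ` hedges H"
    using assms(5) by (auto simp: hypergraph_iso_def)
  \<comment> \<open>Relabelling along \<open>f\<close> turns \<open>vs\<close> into an enumeration
    of the concrete hypergraph with the same adjacency matrix.\<close>
  have "distinct (map f vs)" "set (map f vs) = verts (double_hyperstar k n1 n2)"
    using f(1) assms(6,7) by (auto simp: distinct_map bij_betw_def)
  note char_poly_double_hyperstar[OF assms(1-3) this]
  moreover have "?Q \<noteq> 0"
    using degree_double_hyperstar_quintic by (metis degree_0 zero_neq_numeral)
  moreover have "repeat_mset n {#a#} = replicate_mset n a" for n and a :: complex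
    by (simp add: multiset_eq_iff)
  ultimately have "eigenvalue_mset (adjacency_matrix vs H) =
      replicate_mset ((k - 2) * (n1 + n2 - 1) - 1) (- 1)
      + replicate_mset (n1 + n2 - 4) (of_nat (k - 2)) + proots ?Q"
    by (simp add: eigenvalue_mset_def adjacency_matrix_iso[OF f assms(4,7)] proots_mult proots_power)
  moreover obtain rs where rs: "mset rs = proots ?Q"
    by (metis ex_mset)
  moreover have "length rs = 5"
    using rs by (metis degree_double_hyperstar_quintic size_mset size_proots_complex)
  then obtain r1 r2 r3 r4 r5 where "rs = [r1, r2, r3, r4, r5]"
    by (auto simp: eval_nat_numeral length_Suc_conv)
  ultimately show ?thesis
    by (metis mset.simps)
qed

end
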